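(* Let $M$ be a real $n\times n$ Z-matrix. Then $M$ is a quasi non-singular $M$-matrix if and only if \[ \det(M+D)>\det(M+D')>\det(M) \] for all real diagonal matrices $D,D'$ with $D>D'>0$.
   Context: A real square matrix $M=(m_{ij})$ is a Z-matrix if $m_{ij}\le 0$ for all $i\ne j$. A real Z-matrix is a quasi non-singular $M$-matrix if all its proper principal minors (principal minors indexed by proper subsets of the index set) are positive. For real matrices (or vectors) the partial order is entrywise: $A\le B$ iff $a_{ij}\le b_{ij}$ for all entries, and $A<B$ iff $A\le B$ and $A\neq B$. Thus $D>D'>0$ means $D'\ge 0$ entrywise with $D'\neq 0$, and $D\ge D'$ entrywise with $D\neq D'$. *)

theory Defs
  imports "Jordan_Normal_Form.Determinant" "Jordan_Normal_Form.DL_Submatrix"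
begin

text \<open>The library order on matrices is already the entrywise one: \<open>A \<le> B\<close> compares all
  entries of matrices of equal dimensions, and \<open>A < B\<close> is \<open>A \<le> B \<and> \<not> B \<le> A\<close>, which for real
  matrices means \<open>A \<le> B \<and> A \<noteq> B\<close>; it does not mean strict inequality in every entry.\<close>

definition Z_matrix :: "real mat \<Rightarrow> bool" where
  "Z_matrix M \<longleftrightarrow> square_mat M \<and>
     (\<forall>i < dim_row M. \<forall>j < dim_row M. i \<noteq> j \<longrightarrow> M $$ (i, j) \<le> 0)"

definition principal_minor :: "real mat \<Rightarrow> nat set \<Rightarrow> real" where
  "principal_minor M S = det (submatrix M S S)"

text \<open>The empty index set is a proper subset here (for positive dimension); its principal minor
  is the determinant of the \<open>0 \<times> 0\<close> matrix, which is \<open>1\<close>, so this imposes no condition.\<close>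

definition quasi_nonsingular_M_matrix :: "real mat \<Rightarrow> bool" where
  "quasi_nonsingular_M_matrix M \<longleftrightarrow> Z_matrix M \<and>
     (\<forall>S. S \<subset> {0..<dim_row M} \<longrightarrow> principal_minor M S > 0)"

end

theory Submission
  imports Defs
begin

text \<open>For a matrix indexed by a finite set \<open>S\<close>, the determinant of \<open>A + diag d\<close> is the polynomial
  \<open>\<Sum>T\<subseteq>S. (\<Prod>i\<in>T. d i) * det A[S - T]\<close>, so positive proper principal minors make it strictly
  increasing in \<open>d \<ge> 0\<close>.

  Conversely, the slope of the determinant in \<open>d i\<close> is the minor of \<open>A + diag d\<close> on \<open>S - {i}\<close>;
  monotonicity makes it positive, and a polynomial that is affine in each \<open>d j\<close> and bounded below on
  \<open>d \<ge> 0\<close> has nonnegative slopes, so by descent all proper principal minors are nonnegative. For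
  a Z-matrix whose proper principal minors are nonnegative, all cofactors are nonnegative, hence
  \<open>det A \<le> A i i * det A[S - {i}]\<close>. A positive minor therefore forces all smaller ones to be
  positive.\<close>

section \<open>Determinants over finite index sets\<close>

text \<open>Leibniz formula with an arbitrary index set: principal minors of minors are then the
  same function at smaller sets, with no renumbering of rows.\<close>

definition set_det :: "('a \<Rightarrow> 'a \<Rightarrow> 'b::comm_ring_1) \<Rightarrow> 'a set \<Rightarrow> 'b" where
  "set_det A S = (\<Sum>p | p permutes S. of_int (sign p) * (\<Prod>i\<in>S. A i (p i)))"

text \<open>The coefficient of \<open>A j k\<close> in \<open>set_det A S\<close>, sign included.
  Selecting permutations by \<open>p j = k\<close> replaces the usual factor (-1)^(j+k), which would
  need an ordered index set.\<close>

definition set_cofactor :: "('a \<Rightarrow> 'a \<Rightarrow> 'b::comm_ring_1) \<Rightarrow> 'a set \<Rightarrow> 'a \<Rightarrow> 'a \<Rightarrow> 'b" where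
  "set_cofactor A S j k =
     (\<Sum>p | p permutes S \<and> p j = k. of_int (sign p) * (\<Prod>i\<in>S - {j}. A i (p i)))"

definition diag_shift :: "('a \<Rightarrow> 'a \<Rightarrow> 'b::comm_ring_1) \<Rightarrow> ('a \<Rightarrow> 'b) \<Rightarrow> 'a \<Rightarrow> 'a \<Rightarrow> 'b" where
  "diag_shift A d i j = A i j + (if i = j then d i else 0)"

lemma set_det_cong:
  assumes "\<And>i j. i \<in> S \<Longrightarrow> j \<in> S \<Longrightarrow> A i j = B i j"
  shows "set_det A S = set_det B S"
  unfolding set_det_def using assms
  by (intro sum.cong refl arg_cong2[where f="(*)"] prod.cong) (auto simp: permutes_in_image)

lemma set_det_empty [simp]: "set_det A {} = 1"
  by (simp add: set_det_def)

text \<open>Conjugation by \<open>f\<close> matches the permutations of \<open>S\<close> with those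
  of \<open>T\<close> and preserves signs. This absorbs the renumbering that
  \<open>submatrix\<close> performs.\<close>

lemma set_det_reindex:
  assumes "finite S" and bij: "bij_betw f S T"
  shows "set_det A T = set_det (\<lambda>i j. A (f i) (f j)) S"
proof -
  let ?g = "inv_into S f"
  have inj: "inj_on f S" using bij by (simp add: bij_betw_def)
  have bg: "bij_betw ?g T S" using bij by (rule bij_betw_inv_into)
  show ?thesis unfolding set_det_def
  proof (rule sum.reindex_bij_witness[of _ "map_permutation S f" "map_permutation T ?g"])
    fix p assume "p \<in> {p. p permutes T}"
    then have p: "p permutes T" by simp
    show "map_permutation S f (map_permutation T ?g p) = p"
      by (rule map_permutation_compose_inv[OF bg p])
         (use bij in \<open>auto simp: bij_betw_def f_inv_into_f\<close>)
    show "map_permutation T ?g p \<in> {p. p permutes S}"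
      using map_permutation_permutes[OF bg p] by simp
    have fin: "finite T" using assms bij_betw_finite by blast
    have s: "sign (map_permutation T ?g p) = sign p"
      by (rule sign_map_permutation) (use bg p fin in \<open>auto simp: bij_betw_def\<close>)
    have "(\<Prod>i\<in>T. A i (p i)) = (\<Prod>i\<in>S. A (f i) (p (f i)))"
      by (rule prod.reindex_bij_betw[OF bij, symmetric])
    also have "\<dots> = (\<Prod>i\<in>S. A (f i) (f (map_permutation T ?g p i)))"
    proof (rule prod.cong[OF refl])
      fix i assume i: "i \<in> S"
      then have fi: "f i \<in> T" using bij by (auto simp: bij_betw_def)
      have "map_permutation T ?g p (?g (f i)) = ?g (p (f i))"
        by (rule map_permutation_apply) (use bg fi in \<open>auto simp: bij_betw_def\<close>)
      moreover have "p (f i) \<in> f ` S"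
        using fi p bij by (simp add: permutes_in_image bij_betw_def)
      ultimately have "f (map_permutation T ?g p i) = p (f i)"
        using i inj by (simp add: f_inv_into_f)
      then show "A (f i) (p (f i)) = A (f i) (f (map_permutation T ?g p i))" by simp
    qed
    finally show "of_int (sign (map_permutation T ?g p)) *
        (\<Prod>i\<in>S. A (f i) (f (map_permutation T ?g p i))) = of_int (sign p) * (\<Prod>i\<in>T. A i (p i))"
      using s by simp
  next
    fix p assume "p \<in> {p. p permutes S}"
    then have p: "p permutes S" by simp
    show "map_permutation T ?g (map_permutation S f p) = p"
      by (rule map_permutation_compose_inv[OF bij p]) (use inj in auto)
    show "map_permutation S f p \<in> {p. p permutes T}"
      using map_permutation_permutes[OF bij p] by simp
  qed
qed

section \<open>Matrix determinants and principal minors as set determinants\<close>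

lemma det_eq_set_det:
  fixes A :: "real mat"
  assumes "A \<in> carrier_mat n n"
  shows "det A = set_det (\<lambda>i j. A $$ (i, j)) {0..<n}"
  by (simp add: det_def'[OF assms] set_det_def sign_def)

lemma principal_minor_eq_set_det:
  assumes A: "A \<in> carrier_mat n n" and S: "S \<subseteq> {0..<n}"
  shows "principal_minor A S = set_det (\<lambda>i j. A $$ (i, j)) S"
proof -
  have fin: "finite S" using S finite_subset by blast
  \<comment> \<open>\<open>submatrix\<close> keeps only the indices of \<open>S\<close> below the
    dimension; here these are all of \<open>S\<close>.\<close>
  have eq: "{i. i < n \<and> i \<in> S} = S" using S by auto
  have c: "submatrix A S S \<in> carrier_mat (card S) (card S)"
    using A eq by (intro carrier_matI) (simp_all only: dim_submatrix carrier_matD[OF A])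
  have inj: "inj_on (pick S) {0..<card S}"
  proof (rule linorder_inj_onI)
    fix i j assume "i < j" "i \<in> {0..<card S}" "j \<in> {0..<card S}"
    then show "pick S i \<noteq> pick S j" using pick_mono_le[of j S i] by auto
  qed auto
  have "pick S ` {0..<card S} = S"
    by (rule card_subset_eq[OF fin]) (use pick_in_set_le inj in \<open>auto simp: card_image\<close>)
  with inj have bij: "bij_betw (pick S) {0..<card S} S" by (simp add: bij_betw_def)
  have "principal_minor A S = set_det (\<lambda>i j. submatrix A S S $$ (i, j)) {0..<card S}"
    unfolding principal_minor_def by (rule det_eq_set_det[OF c])
  also have "\<dots> = set_det (\<lambda>i j. A $$ (pick S i, pick S j)) {0..<card S}"
    by (rule set_det_cong) (use A in \<open>simp add: submatrix_index eq\<close>)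
  also have "\<dots> = set_det (\<lambda>i j. A $$ (i, j)) S"
    by (rule set_det_reindex[OF _ bij, symmetric]) simp
  finally show ?thesis .
qed

section \<open>Diagonal shifts and cofactor expansion\<close>

text \<open>Multiply out each Leibniz product, with \<open>X\<close> the set of rows contributing
  their diagonal term. A permutation survives only if it fixes \<open>X\<close> pointwise, that is,
  if it permutes \<open>S - X\<close>.\<close>

lemma set_det_diag_shift:
  assumes fin: "finite S"
  shows "set_det (diag_shift A d) S = (\<Sum>T\<in>Pow S. (\<Prod>i\<in>T. d i) * set_det A (S - T))"
proof -
  let ?t = "\<lambda>p X. of_int (sign p) *
    ((\<Prod>i\<in>X. if i = p i then d i else 0) * (\<Prod>i\<in>S - X. A i (p i)))"
  have "set_det (diag_shift A d) S = (\<Sum>p | p permutes S. \<Sum>X\<in>Pow S. ?t p X)"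
    unfolding set_det_def diag_shift_def
    \<comment> \<open>Commuting the sum puts the diagonal term first, so that the subset in
      \<open>prod_add\<close> collects the diagonal choices.\<close>
    by (subst add.commute, subst prod_add[OF fin]) (simp add: sum_distrib_left)
  also have "\<dots> = (\<Sum>X\<in>Pow S. \<Sum>p | p permutes S. ?t p X)"
    by (rule sum.swap)
  also have "\<dots> = (\<Sum>X\<in>Pow S. (\<Prod>i\<in>X. d i) * set_det A (S - X))"
  proof (rule sum.cong[OF refl])
    fix X assume "X \<in> Pow S"
    then have X: "X \<subseteq> S" by simp
    then have finX: "finite X" using fin finite_subset by blast
    have "(\<Sum>p | p permutes S. ?t p X) = (\<Sum>p | p permutes S - X. ?t p X)"
    proof (rule sum.mono_neutral_right)
      show "finite {p. p permutes S}" using fin by (rule finite_permutations)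
      show "{p. p permutes S - X} \<subseteq> {p. p permutes S}"
        using permutes_subset by blast
      show "\<forall>p\<in>{p. p permutes S} - {p. p permutes S - X}. ?t p X = 0"
      proof
        fix p assume "p \<in> {p. p permutes S} - {p. p permutes S - X}"
        then have "\<exists>x\<in>X. p x \<noteq> x"
          using permutes_superset[of p S "S - X"] by fastforce
        then have "(\<Prod>i\<in>X. if i = p i then d i else 0) = 0"
          using finX by (intro prod_zero) metis+
        then show "?t p X = 0" by simp
      qed
    qed
    also have "\<dots> = (\<Sum>p | p permutes S - X.
        of_int (sign p) * ((\<Prod>i\<in>X. d i) * (\<Prod>i\<in>S - X. A i (p i))))"
      by (intro sum.cong refl arg_cong2[where f="(*)"] prod.cong) (auto simp: permutes_def)
    also have "\<dots> = (\<Prod>i\<in>X. d i) * set_det A (S - X)"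
      by (simp add: set_det_def sum_distrib_left mult_ac)
    finally show "(\<Sum>p | p permutes S. ?t p X) = (\<Prod>i\<in>X. d i) * set_det A (S - X)" .
  qed
  finally show ?thesis .
qed

lemma set_cofactor_diag:
  assumes "j \<in> S"
  shows "set_cofactor A S j j = set_det A (S - {j})"
proof -
  have "{p. p permutes S \<and> p j = j} = {p. p permutes S - {j}}"
    using permutes_superset[of _ S "S - {j}"] permutes_subset[of _ "S - {j}" S]
    by (auto simp: permutes_not_in)
  then show ?thesis by (simp add: set_cofactor_def set_det_def)
qed

text \<open>Laplace expansion, obtained by grouping the permutations by the image of
  \<open>j\<close>.\<close>

lemma set_det_expand_row:
  assumes fin: "finite S" and j: "j \<in> S"
  shows "set_det A S = (\<Sum>k\<in>S. A j k * set_cofactor A S j k)"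
proof -
  let ?h = "\<lambda>p. of_int (sign p) * (\<Prod>i\<in>S. A i (p i))"
  have "set_det A S = (\<Sum>k\<in>S. sum ?h {p \<in> {p. p permutes S}. p j = k})"
    unfolding set_det_def
    by (rule sum.group[symmetric])
       (use fin j in \<open>auto simp: finite_permutations permutes_in_image\<close>)
  also have "\<dots> = (\<Sum>k\<in>S. A j k * set_cofactor A S j k)"
    unfolding set_cofactor_def sum_distrib_left
    by (intro sum.cong refl) (auto simp: prod.remove[OF fin j] mult_ac)
  finally show ?thesis .
qed

text \<open>A permutation with \<open>j \<mapsto> k \<mapsto> l\<close> becomes, after a transposition, one of \<open>S - {k}\<close> with
  \<open>j \<mapsto> l\<close>.\<close>

lemma set_cofactor_offdiag:
  assumes fin: "finite S" and j: "j \<in> S" and k: "k \<in> S" and jk: "j \<noteq> k"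
  shows "set_cofactor A S j k = - (\<Sum>l\<in>S - {k}. A k l * set_cofactor A (S - {k}) j l)"
proof -
  let ?h = "\<lambda>p. of_int (sign p) * (\<Prod>i\<in>S - {j}. A i (p i))"
  let ?P = "{p. p permutes S \<and> p j = k}"
  have finP: "finite ?P"
    by (rule finite_subset[OF _ finite_permutations[OF fin]]) auto
  have img: "(\<lambda>p. p k) ` ?P \<subseteq> S - {k}"
  proof
    fix x assume "x \<in> (\<lambda>p. p k) ` ?P"
    then obtain p where p: "p permutes S" "p j = k" "x = p k" by auto
    have "p k \<noteq> p j" using permutes_inj[OF p(1)] jk by (auto dest: injD)
    then show "x \<in> S - {k}" using p k by (auto simp: permutes_in_image)
  qed
  have "set_cofactor A S j k = (\<Sum>l\<in>S - {k}. sum ?h {p \<in> ?P. p k = l})"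
    unfolding set_cofactor_def
    by (rule sum.group[symmetric]) (use fin finP img in auto)
  also have "\<dots> = (\<Sum>l\<in>S - {k}. - (A k l * set_cofactor A (S - {k}) j l))"
  proof (rule sum.cong[OF refl])
    fix l assume "l \<in> S - {k}"
    then have l: "l \<in> S" "l \<noteq> k" by auto
    let ?\<tau> = "Transposition.transpose k l"
    let ?g = "\<lambda>q. of_int (sign q) * (\<Prod>i\<in>S - {k} - {j}. A i (q i))"
    have tS: "?\<tau> permutes S" using k l by (intro permutes_swap_id)
    have "sum ?h {p \<in> ?P. p k = l} =
        (\<Sum>q | q permutes S - {k} \<and> q j = l. - (A k l * ?g q))"
    proof (rule sum.reindex_bij_witness[of _ "\<lambda>q. ?\<tau> \<circ> q" "\<lambda>p. ?\<tau> \<circ> p"])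
      fix p assume "p \<in> {p \<in> ?P. p k = l}"
      then have p: "p permutes S" "p j = k" "p k = l" by auto
      show "?\<tau> \<circ> (?\<tau> \<circ> p) = p" by (simp add: o_assoc)
      have "?\<tau> \<circ> p permutes S" using p(1) tS by (rule permutes_compose)
      then have "?\<tau> \<circ> p permutes S - {k}"
        by (rule permutes_superset) (use p(3) in auto)
      then show "?\<tau> \<circ> p \<in> {q. q permutes S - {k} \<and> q j = l}"
        using p(2) by simp
      have sg: "sign (?\<tau> \<circ> p) = - sign p"
        using sign_compose[OF permutes_imp_permutation[OF fin tS]
            permutes_imp_permutation[OF fin p(1)]] l(2)
        by (simp add: sign_swap_id)
      have "(\<Prod>i\<in>S - {j}. A i (p i)) = A k l * (\<Prod>i\<in>S - {j} - {k}. A i (p i))"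
        using prod.remove[of "S - {j}" k "\<lambda>i. A i (p i)"] fin k jk p(3) by simp
      \<comment> \<open>The transposition moves only the values \<open>k = p j\<close> and
        \<open>l = p k\<close>, which by injectivity no other index attains.\<close>
      also have "(\<Prod>i\<in>S - {j} - {k}. A i (p i)) = (\<Prod>i\<in>S - {k} - {j}. A i ((?\<tau> \<circ> p) i))"
      proof (rule prod.cong)
        fix i assume i: "i \<in> S - {k} - {j}"
        then have "p i \<noteq> p j" "p i \<noteq> p k"
          using permutes_inj[OF p(1)] by (auto dest: injD)
        then have "(?\<tau> \<circ> p) i = p i" using p(2,3) by simp
        then show "A i (p i) = A i ((?\<tau> \<circ> p) i)" by simp
      qed auto
      finally show "- (A k l * ?g (?\<tau> \<circ> p)) = ?h p" using sg by (simp add: mult_ac)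
    next
      fix q assume "q \<in> {q. q permutes S - {k} \<and> q j = l}"
      then have q: "q permutes S - {k}" "q j = l" by auto
      show "?\<tau> \<circ> (?\<tau> \<circ> q) = q" by (simp add: o_assoc)
      have "q permutes S" using q(1) by (rule permutes_subset) auto
      then have "?\<tau> \<circ> q permutes S" using tS by (rule permutes_compose)
      moreover have "q k = k" using q(1) by (simp add: permutes_not_in)
      ultimately show "?\<tau> \<circ> q \<in> {p \<in> ?P. p k = l}"
        using q(2) by simp
    qed
    also have "\<dots> = - (A k l * set_cofactor A (S - {k}) j l)"
      by (simp add: set_cofactor_def sum_negf sum_distrib_left)
    finally show "sum ?h {p \<in> ?P. p k = l} = - (A k l * set_cofactor A (S - {k}) j l)" .
  qed
  finally show ?thesis by (simp add: sum_negf)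
qed

text \<open>The cofactors of row \<open>i\<close> do not involve row \<open>i\<close>, so the
  determinant is affine in \<open>d i\<close>, with the complementary minor as slope.\<close>

lemma set_det_diag_entry:
  assumes fin: "finite S" and i: "i \<in> S"
  shows "set_det (diag_shift A (d(i := d i + s))) S =
    set_det (diag_shift A d) S + s * set_det (diag_shift A d) (S - {i})"
proof -
  let ?B = "diag_shift A d" and ?C = "diag_shift A (d(i := d i + s))"
  have cof: "set_cofactor ?C S i k = set_cofactor ?B S i k" for k
    unfolding set_cofactor_def
    by (intro sum.cong refl arg_cong2[where f="(*)"] prod.cong) (auto simp: diag_shift_def)
  have "set_det ?C S = (\<Sum>k\<in>S. ?B i k * set_cofactor ?B S i k +
      (if k = i then s * set_cofactor ?B S i i else 0))"
    unfolding set_det_expand_row[OF fin i] cof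
    by (intro sum.cong refl) (auto simp: diag_shift_def algebra_simps)
  also have "\<dots> = set_det ?B S + s * set_det ?B (S - {i})"
    using fin i
    by (simp add: sum.distrib set_det_expand_row[OF fin i, of ?B] set_cofactor_diag[OF i])
  finally show ?thesis .
qed

section \<open>Sign arguments for Z-matrices\<close>

text \<open>Diagonal cofactors are proper principal minors. An off-diagonal one is minus a sum of
  nonpositive entries times cofactors of \<open>S - {k}\<close>, which are nonnegative by
  induction.\<close>

lemma Z_cofactor_nonneg:
  fixes A :: "'a \<Rightarrow> 'a \<Rightarrow> real"
  assumes "finite S"
    and "\<And>i j. i \<in> S \<Longrightarrow> j \<in> S \<Longrightarrow> i \<noteq> j \<Longrightarrow> A i j \<le> 0"
    and "\<And>T. T \<subset> S \<Longrightarrow> set_det A T \<ge> 0"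
    and "j \<in> S" "k \<in> S"
  shows "set_cofactor A S j k \<ge> 0"
  using assms
proof (induction S arbitrary: j k rule: finite_psubset_induct)
  case (psubset S)
  show ?case
  proof (cases "j = k")
    case True
    have "S - {k} \<subset> S" using psubset.prems by auto
    with True show ?thesis using psubset.prems by (simp add: set_cofactor_diag)
  next
    case False
    have "A k l * set_cofactor A (S - {k}) j l \<le> 0" if l: "l \<in> S - {k}" for l
    proof (rule mult_nonpos_nonneg)
      show "A k l \<le> 0" using psubset.prems l by auto
      show "set_cofactor A (S - {k}) j l \<ge> 0"
        by (rule psubset.IH) (use psubset.prems False l in auto)
    qed
    then have "(\<Sum>l\<in>S - {k}. A k l * set_cofactor A (S - {k}) j l) \<le> 0"
      by (rule sum_nonpos)
    then show ?thesis
      using set_cofactor_offdiag[OF \<open>finite S\<close> psubset.prems(3,4) False, of A] by simp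
  qed
qed

text \<open>In the expansion along row \<open>i\<close>, each off-diagonal term is a nonpositive
  entry times a nonnegative cofactor.\<close>

lemma Z_det_le:
  fixes A :: "'a \<Rightarrow> 'a \<Rightarrow> real"
  assumes fin: "finite S"
    and Z: "\<And>i j. i \<in> S \<Longrightarrow> j \<in> S \<Longrightarrow> i \<noteq> j \<Longrightarrow> A i j \<le> 0"
    and minors: "\<And>T. T \<subset> S \<Longrightarrow> set_det A T \<ge> 0"
    and i: "i \<in> S"
  shows "set_det A S \<le> A i i * set_det A (S - {i})"
proof -
  have "(\<Sum>k\<in>S - {i}. A i k * set_cofactor A S i k) \<le> 0"
  proof (rule sum_nonpos, rule mult_nonpos_nonneg)
    fix k assume k: "k \<in> S - {i}"
    show "A i k \<le> 0" using Z i k by auto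
    show "set_cofactor A S i k \<ge> 0"
      by (rule Z_cofactor_nonneg[OF fin Z minors]) (use i k in auto)
  qed
  moreover have "set_det A S = A i i * set_det A (S - {i}) +
      (\<Sum>k\<in>S - {i}. A i k * set_cofactor A S i k)"
    unfolding set_det_expand_row[OF fin i] sum.remove[OF fin i]
    by (simp add: set_cofactor_diag[OF i])
  ultimately show ?thesis by simp
qed

text \<open>Indices are removed one at a time. By \<open>Z_det_le\<close> a positive minor is at
  most a multiple of the next smaller one, which therefore cannot vanish.\<close>

lemma Z_minors_pos:
  fixes A :: "'a \<Rightarrow> 'a \<Rightarrow> real"
  assumes fin: "finite S"
    and Z: "\<And>i j. i \<in> S \<Longrightarrow> j \<in> S \<Longrightarrow> i \<noteq> j \<Longrightarrow> A i j \<le> 0"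
    and minors: "\<And>T. T \<subseteq> S \<Longrightarrow> set_det A T \<ge> 0"
    and pos: "set_det A S > 0" and T: "T \<subseteq> S"
  shows "set_det A T > 0"
proof -
  have "set_det A (S - U) > 0" if "finite U" "U \<subseteq> S" for U
    using that
  proof (induction U)
    case empty
    then show ?case using pos by simp
  next
    case (insert x U)
    let ?R = "S - U"
    have eq: "S - insert x U = ?R - {x}" by auto
    have "set_det A ?R \<le> A x x * set_det A (?R - {x})"
      by (rule Z_det_le) (use fin Z minors insert in auto)
    moreover have "set_det A ?R > 0" using insert by simp
    ultimately have "set_det A (?R - {x}) \<noteq> 0" by auto
    moreover have "set_det A (?R - {x}) \<ge> 0" by (rule minors) auto
    ultimately show ?case unfolding eq by linarith
  qed
  from this[of "S - T"] show ?thesis using fin T by (simp add: double_diff)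
qed

section \<open>Monotonicity under diagonal shifts, and its converse\<close>

lemma set_det_diag_shift_strict_mono:
  fixes A :: "'a \<Rightarrow> 'a \<Rightarrow> real"
  assumes fin: "finite S" and minors: "\<And>T. T \<subset> S \<Longrightarrow> set_det A T > 0"
    and d: "\<And>i. i \<in> S \<Longrightarrow> 0 \<le> d i \<and> d i \<le> e i"
    and j: "j \<in> S" "d j < e j"
  shows "set_det (diag_shift A d) S < set_det (diag_shift A e) S"
  unfolding set_det_diag_shift[OF fin]
proof (rule sum_strict_mono_ex1)
  show "finite (Pow S)" using fin by simp
  show "\<forall>T\<in>Pow S. prod d T * set_det A (S - T) \<le> prod e T * set_det A (S - T)"
  proof
    fix T assume T: "T \<in> Pow S"
    show "prod d T * set_det A (S - T) \<le> prod e T * set_det A (S - T)"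
    \<comment> \<open>The term for the empty set is \<open>set_det A S\<close>, of unknown sign, but
      it is the same on both sides.\<close>
    proof (cases "T = {}")
      case False
      then have "set_det A (S - T) > 0" using T by (intro minors) auto
      moreover have "prod d T \<le> prod e T" using T d by (intro prod_mono) auto
      ultimately show ?thesis by (intro mult_right_mono) auto
    qed simp
  qed
  \<comment> \<open>The singleton \<open>{j}\<close> supplies the strict inequality; for larger sets
    a factor \<open>d i = 0\<close> could make both products vanish.\<close>
  have "prod d {j} * set_det A (S - {j}) < prod e {j} * set_det A (S - {j})"
    using j minors[of "S - {j}"] by (auto intro!: mult_strict_right_mono)
  then show "\<exists>T\<in>Pow S. prod d T * set_det A (S - T) < prod e T * set_det A (S - T)"
    using j by (intro bexI[of _ "{j}"]) auto
qed

text \<open>A negative minor on \<open>R - {x}\<close> would be a negative slope in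
  \<open>d x\<close>, driving the determinant on \<open>R\<close> below zero. The induction
  generalizes over \<open>d\<close> because it is applied to the increased shift.\<close>

lemma shifted_minors_nonneg:
  fixes A :: "'a \<Rightarrow> 'a \<Rightarrow> real"
  assumes fin: "finite S"
    and top: "\<And>d. (\<And>i. i \<in> S \<Longrightarrow> d i \<ge> 0) \<Longrightarrow> set_det (diag_shift A d) S \<ge> 0"
    and T: "T \<subseteq> S" and d: "\<And>i. i \<in> S \<Longrightarrow> d i \<ge> 0"
  shows "set_det (diag_shift A d) T \<ge> 0"
proof -
  have "set_det (diag_shift A d) (S - U) \<ge> 0"
    if "finite U" "U \<subseteq> S" "\<And>i. i \<in> S \<Longrightarrow> d i \<ge> 0" for U d
    using that
  proof (induction U arbitrary: d)
    case empty
    then show ?case using top by simp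
  next
    case (insert x U)
    let ?R = "S - U" and ?b = "set_det (diag_shift A d)"
    have eq: "S - insert x U = ?R - {x}" by auto
    show ?case unfolding eq
    proof (rule ccontr)
      assume "\<not> 0 \<le> ?b (?R - {x})"
      then have neg: "?b (?R - {x}) < 0" by simp
      have R: "0 \<le> ?b ?R" using insert by auto
      \<comment> \<open>Chosen so that the affine function of the shift takes the value -1;
        \<open>s\<close> is nonnegative because the determinant on \<open>R\<close> is.\<close>
      define s where "s = (?b ?R + 1) / (- ?b (?R - {x}))"
      have s: "s \<ge> 0" "s * ?b (?R - {x}) = - (?b ?R + 1)"
        using R neg by (auto simp: s_def field_simps)
      have "0 \<le> set_det (diag_shift A (d(x := d x + s))) ?R"
        by (rule insert.IH) (use insert.prems s in auto)
      also have "\<dots> = ?b ?R + s * ?b (?R - {x})"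
        by (rule set_det_diag_entry) (use fin insert in auto)
      also have "\<dots> = -1" using s by simp
      finally show False by simp
    qed
  qed
  from this[of "S - T" d] show ?thesis using fin T d by (simp add: double_diff)
qed

text \<open>The assumption \<open>mono\<close> is the determinant condition for functions in place
  of diagonal matrices. Unit increments of one coordinate turn it into positivity of the minors on
  \<open>S - {i}\<close> under every nonnegative shift.\<close>

lemma Z_minors_pos_of_mono:
  fixes A :: "'a \<Rightarrow> 'a \<Rightarrow> real"
  assumes fin: "finite S"
    and Z: "\<And>i j. i \<in> S \<Longrightarrow> j \<in> S \<Longrightarrow> i \<noteq> j \<Longrightarrow> A i j \<le> 0"
    and mono: "\<And>d e i j. (\<And>i. i \<in> S \<Longrightarrow> 0 \<le> d i \<and> d i \<le> e i) \<Longrightarrow>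
      i \<in> S \<Longrightarrow> 0 < d i \<Longrightarrow> j \<in> S \<Longrightarrow> d j < e j \<Longrightarrow>
      set_det (diag_shift A d) S < set_det (diag_shift A e) S \<and>
      set_det A S < set_det (diag_shift A d) S"
    and T: "T \<subset> S"
  shows "set_det A T > 0"
proof -
  have z: "diag_shift A (\<lambda>_. 0) = A" by (auto simp: diag_shift_def fun_eq_iff)
  have slope: "set_det (diag_shift A d) (S - {i}) > 0"
    if i: "i \<in> S" and d: "\<And>i. i \<in> S \<Longrightarrow> 0 \<le> d i" for i d
  proof (cases "\<exists>k\<in>S. d k > 0")
    case True
    then obtain k where k: "k \<in> S" "d k > 0" by auto
    have "set_det (diag_shift A d) S < set_det (diag_shift A (d(i := d i + 1))) S"
      using mono[of d "d(i := d i + 1)" k i] d i k by auto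
    then show ?thesis using set_det_diag_entry[OF fin i, of A d 1] by simp
  next
    \<comment> \<open>The zero shift is excluded from the first inequality in \<open>mono\<close>,
      so the second one is used, with a unit shift at \<open>i\<close>. The larger shift only has to
      exist.\<close>
    case False
    then have "d k = 0" if "k \<in> S" for k using d that by force
    then have eq: "set_det (diag_shift A d) (S - {i}) = set_det A (S - {i})"
      by (intro set_det_cong) (auto simp: diag_shift_def)
    \<comment> \<open>Written as \<open>0 + 1\<close> to match the form of
      \<open>set_det_diag_entry\<close>.\<close>
    let ?u = "(\<lambda>_. 0)(i := 0 + 1) :: 'a \<Rightarrow> real"
    have "set_det A S < set_det (diag_shift A ?u) S"
      using mono[of ?u "\<lambda>k. ?u k + 1" i i] i by auto
    then show ?thesis
      using set_det_diag_entry[OF fin i, of A "\<lambda>_. 0" 1] unfolding eq z by simp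
  qed
  from T obtain i where i: "i \<in> S" "T \<subseteq> S - {i}" by auto
  show ?thesis
  proof (rule Z_minors_pos[of "S - {i}"])
    show "set_det A U \<ge> 0" if "U \<subseteq> S - {i}" for U
    proof -
      have "set_det (diag_shift A (\<lambda>_. 0)) U \<ge> 0"
      proof (rule shifted_minors_nonneg[of "S - {i}"])
        fix d :: "'a \<Rightarrow> real" assume d: "\<And>k. k \<in> S - {i} \<Longrightarrow> 0 \<le> d k"
        \<comment> \<open>Nothing is known about \<open>d i\<close>; resetting it to 0 leaves the
          minor unchanged and makes \<open>slope\<close> applicable.\<close>
        have "set_det (diag_shift A d) (S - {i}) = set_det (diag_shift A (d(i := 0))) (S - {i})"
          by (rule set_det_cong) (auto simp: diag_shift_def)
        also have "\<dots> > 0" by (rule slope) (use i d in auto)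
        finally show "0 \<le> set_det (diag_shift A d) (S - {i})" by simp
      qed (use fin that in auto)
      then show ?thesis by (simp add: z)
    qed
    show "set_det A (S - {i}) > 0" using slope[of i "\<lambda>_. 0"] i by (simp add: z)
  qed (use fin Z i in auto)
qed

section \<open>Return to diagonal matrices\<close>

lemma det_add_diagonal:
  fixes M D :: "real mat"
  assumes "M \<in> carrier_mat n n" "D \<in> carrier_mat n n" "diagonal_mat D"
  shows "det (M + D) =
    set_det (diag_shift (\<lambda>i j. M $$ (i, j)) (\<lambda>i. D $$ (i, i))) {0..<n}"
proof -
  have "M + D \<in> carrier_mat n n" using assms by simp
  from det_eq_set_det[OF this] show ?thesis
    using assms by (auto simp: diag_shift_def diagonal_mat_def intro!: set_det_cong)
qed

lemma diagonal_mat_less_iff: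
  fixes D E :: "real mat"
  assumes "D \<in> carrier_mat n n" "E \<in> carrier_mat n n" "diagonal_mat D" "diagonal_mat E"
  shows "D < E \<longleftrightarrow> (\<forall>i<n. D $$ (i, i) \<le> E $$ (i, i)) \<and> (\<exists>i<n. D $$ (i, i) < E $$ (i, i))"
proof -
  \<comment> \<open>Stated for arbitrary matrices because the strict order unfolds to this
    comparison in one direction and its negation in the other.\<close>
  have le: "D \<le> E \<longleftrightarrow> (\<forall>i<n. D $$ (i, i) \<le> E $$ (i, i))"
    if "D \<in> carrier_mat n n" "E \<in> carrier_mat n n" "diagonal_mat D" "diagonal_mat E"
    for D E :: "real mat"
  proof -
    have "D $$ (i, j) \<le> E $$ (i, j)" if "\<forall>i<n. D $$ (i, i) \<le> E $$ (i, i)" "i < n" "j < n" for i j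
      using \<open>diagonal_mat D\<close> \<open>diagonal_mat E\<close> \<open>D \<in> carrier_mat n n\<close> \<open>E \<in> carrier_mat n n\<close> that
      by (cases "i = j") (auto simp: diagonal_mat_def)
    then show ?thesis using that by (auto simp: less_eq_mat_def)
  qed
  show ?thesis
    unfolding less_mat_def le[OF assms] le[OF assms(2,1,4,3)] by (auto simp: not_le)
qed

theorem theorem2p14:
  fixes M :: "real mat" and n :: nat
  assumes "M \<in> carrier_mat n n" and "Z_matrix M"
  shows "quasi_nonsingular_M_matrix M \<longleftrightarrow>
    (\<forall>D \<in> carrier_mat n n. \<forall>D' \<in> carrier_mat n n.
       diagonal_mat D \<and> diagonal_mat D' \<and> D > D' \<and> D' > 0\<^sub>m n n \<longrightarrow>
       det (M + D) > det (M + D') \<and> det (M + D') > det M)"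
    (is "_ \<longleftrightarrow> ?mono")
proof -
  let ?A = "\<lambda>i j. M $$ (i, j)" and ?S = "{0..<n}"
  have dim: "dim_row M = n" using assms by simp
  have zero: "0\<^sub>m n n \<in> carrier_mat n n" "diagonal_mat (0\<^sub>m n n :: real mat)"
    by (auto simp: diagonal_mat_def)
  have "quasi_nonsingular_M_matrix M \<longleftrightarrow> (\<forall>T. T \<subset> ?S \<longrightarrow> set_det ?A T > 0)"
    using assms(2) principal_minor_eq_set_det[OF assms(1)]
    by (auto simp: quasi_nonsingular_M_matrix_def dim dest: psubset_imp_subset)
  also have "\<dots> \<longleftrightarrow> ?mono"
  proof
    assume minors: "\<forall>T. T \<subset> ?S \<longrightarrow> set_det ?A T > 0"
    \<comment> \<open>Allowing \<open>D\<close> to be zero lets one claim yield both required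
      inequalities.\<close>
    have *: "det (M + D) < det (M + E)"
      if D: "D \<in> carrier_mat n n" "diagonal_mat D" "0\<^sub>m n n \<le> D"
        and E: "E \<in> carrier_mat n n" "diagonal_mat E" and DE: "D < E" for D E :: "real mat"
    proof -
      from DE obtain j where "j < n" "D $$ (j, j) < E $$ (j, j)"
        and le: "\<forall>i<n. D $$ (i, i) \<le> E $$ (i, i)"
        using diagonal_mat_less_iff[OF D(1) E(1) D(2) E(2)] by auto
      moreover have "0 \<le> D $$ (i, i)" if "i < n" for i
        using D that by (auto simp: less_eq_mat_def)
      ultimately show ?thesis
        unfolding det_add_diagonal[OF assms(1) D(1,2)] det_add_diagonal[OF assms(1) E]
        using minors by (intro set_det_diag_shift_strict_mono[of _ _ _ _ j]) auto
    qed
    show ?mono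
    proof (intro ballI impI)
      fix D D' :: "real mat" assume c: "D \<in> carrier_mat n n" "D' \<in> carrier_mat n n"
        and h: "diagonal_mat D \<and> diagonal_mat D' \<and> D > D' \<and> D' > 0\<^sub>m n n"
      have "det (M + 0\<^sub>m n n) < det (M + D')" using c h zero by (intro *) auto
      moreover have "det (M + D') < det (M + D)" using c h by (intro *) auto
      ultimately show "det (M + D) > det (M + D') \<and> det (M + D') > det M"
        using assms(1) by simp
    qed
  next
    assume mono: ?mono
    show "\<forall>T. T \<subset> ?S \<longrightarrow> set_det ?A T > 0"
    proof (intro allI impI, rule Z_minors_pos_of_mono[of ?S])
      fix d e :: "nat \<Rightarrow> real" and i j
      assume de: "\<And>i. i \<in> ?S \<Longrightarrow> 0 \<le> d i \<and> d i \<le> e i"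
        and i: "i \<in> ?S" "0 < d i" and j: "j \<in> ?S" "d j < e j"
      \<comment> \<open>Nonnegative functions are realized as diagonal matrices, so that the matrix
        hypothesis gives the condition on functions.\<close>
      define diag where "diag f = mat n n (\<lambda>(i, j). if i = j then f i else 0)"
        for f :: "nat \<Rightarrow> real"
      have c: "diag f \<in> carrier_mat n n" "diagonal_mat (diag f)" for f
        by (auto simp: diag_def diagonal_mat_def)
      have entry: "diag f $$ (k, k) = f k" if "k < n" for f k using that by (simp add: diag_def)
      have "diag d < diag e" "0\<^sub>m n n < diag d"
        unfolding diagonal_mat_less_iff[OF c(1) c(1) c(2) c(2)]
          diagonal_mat_less_iff[OF zero(1) c(1) zero(2) c(2)]
        using de i j by (auto simp: entry)
      then have "det (M + diag d) < det (M + diag e) \<and> det M < det (M + diag d)"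
        using mono c by blast
      moreover have "det (M + diag f) = set_det (diag_shift ?A f) ?S" for f
        unfolding det_add_diagonal[OF assms(1) c]
        by (rule set_det_cong) (auto simp: diag_shift_def entry)
      ultimately show "set_det (diag_shift ?A d) ?S < set_det (diag_shift ?A e) ?S \<and>
          set_det ?A ?S < set_det (diag_shift ?A d) ?S"
        by (simp add: det_eq_set_det[OF assms(1)])
    qed (use assms(2) in \<open>auto simp: Z_matrix_def dim\<close>)
  qed
  finally show ?thesis .
qed

end
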